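(* For every $c\in\mathbb{R}$, $$\mathbb{P}\left(G\left(n,\frac{\log n+c}{n}\right)\text{ is connected}\right)\xrightarrow[n\to\infty]{}\mathrm{e}^{-\mathrm{e}^{-c}}.$$
   Context: $G(n,p)$ is the Erdős–Rényi random graph on $n$ vertices in which each of the $\binom{n}{2}$ edges is present independently with probability $p$. Here $n$ ranges over integers large enough that $\frac{\log n+c}{n}\in[0,1]$, and $\log$ is the natural logarithm. *)

theory Defs
  imports
    "HOL-Probability.Probability"
    "HOL-Probability.Product_PMF"
    "Graph_Theory.Digraph_Component"
begin

definition possible_edges :: "nat \<Rightarrow> nat set set" where
  "possible_edges n = {e. e \<subseteq> {..<n} \<and> card e = 2}"

(* An undirected edge {u, v} is represented by the two opposite arcs (u, v) and (v, u). *)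
definition simple_graph :: "nat \<Rightarrow> nat set set \<Rightarrow> nat pair_pre_digraph" where
  "simple_graph n E = \<lparr> pverts = {..<n}, parcs = {(u, v). {u, v} \<in> E} \<rparr>"

(* For p outside [0, 1], bernoulli_pmf p truncates p to that interval. *)
definition gnp :: "nat \<Rightarrow> real \<Rightarrow> nat pair_pre_digraph pmf" where
  "gnp n p =
     map_pmf (\<lambda>f. simple_graph n {e \<in> possible_edges n. f e})
       (Pi_pmf (possible_edges n) False (\<lambda>_. bernoulli_pmf p))"

lemma pair_graph_simple_graph:
  assumes "E \<subseteq> possible_edges n"
  shows "pair_graph (simple_graph n E)"
proof -
  have E: "u < n \<and> v < n \<and> u \<noteq> v" if "{u, v} \<in> E" for u v
    using that assms by (auto simp: possible_edges_def subset_iff card_2_iff doubleton_eq_iff)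
  show ?thesis
  proof
    have "parcs (simple_graph n E) \<subseteq> {..<n} \<times> {..<n}"
      using E by (auto simp: simple_graph_def)
    then show "finite (parcs (simple_graph n E))"
      by (rule finite_subset) simp
    show "symmetric (with_proj (simple_graph n E))"
      by (auto simp: symmetric_def simple_graph_def insert_commute intro!: symI)
  qed (use E in \<open>auto simp: simple_graph_def\<close>)
qed

corollary pair_graph_gnp:
  assumes "G \<in> set_pmf (gnp n p)"
  shows "pair_graph G"
  using assms by (auto simp: gnp_def intro!: pair_graph_simple_graph)

end

theory Submission
  imports Defs "HOL-Real_Asymp.Real_Asymp"
begin

text \<open>
  Put \<open>p = (ln n + c) / n\<close>. A connected graph has no isolated vertex, and the probability of that
  is given exactly by inclusion-exclusion as
  \<open>\<Sum>k. (-1) ^ k * (n choose k) * (1 - p) ^ (k * n - (Suc k choose 2))\<close>. The \<open>k\<close>-th term tends to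
  \<open>(- exp (- c)) ^ k / k!\<close>, and Tannery's theorem applies because the terms are bounded by
  \<open>(C * sqrt k) ^ k / k!\<close>; this rests on \<open>n powr (k / n) = O(k)\<close> for \<open>1 \<le> k \<le> n\<close>.

  If a disconnected graph has no isolated vertex, then some set \<open>S\<close> with \<open>2 \<le> |S| \<le> n / 2\<close> has no
  edge to its complement but contains an edge. The same domination, together with the extra
  factor \<open>p\<close> for that one edge, makes the union bound over all \<open>S\<close> an \<open>O(p)\<close>.
\<close>

section \<open>Uniform domination of the terms\<close>

text \<open>\<open>ln x / x\<close> decreases beyond \<open>exp 1\<close>, so for
  \<open>j >= 3\<close> the left side is at most \<open>exp (ln j) = j\<close>. For
  \<open>j <= 2\<close> the crude \<open>ln n <= n\<close> gives \<open>exp 1 ^ j\<close>, for which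
  the constant 8 leaves ample room.\<close>

lemma exp_mult_ln_div_le:
  assumes "1 \<le> j" "j \<le> n"
  shows "exp (real j * ln (real n) / real n) \<le> 8 * real j"
proof (cases "j \<ge> 3")
  case True
  have "ln (real n) / real n \<le> ln (real j) / real j"
    using assms True e_less_272 by (intro ln_x_over_x_mono) auto
  then have "real j * (ln (real n) / real n) \<le> real j * (ln (real j) / real j)"
    by (intro mult_left_mono) auto
  then have "exp (real j * ln (real n) / real n) \<le> exp (ln (real j))"
    using assms by (subst exp_le_cancel_iff) simp
  also have "\<dots> = real j"
    using assms by simp
  finally show ?thesis by simp
next
  case False
  have "ln (real n) \<le> real n"
    using assms by (intro order.trans[OF ln_le_minus_one]) auto
  then have "real j * ln (real n) / real n \<le> real j"
    using assms by (simp add: divide_simps)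
  then have "exp (real j * ln (real n) / real n) \<le> exp 1 ^ j"
    by (simp flip: exp_of_nat_mult)
  also have "\<dots> \<le> (272 / 100) ^ j"
    using e_less_272 by (intro power_mono) auto
  also have "\<dots> \<le> 8 * real j"
  proof -
    have "j = 1 \<or> j = 2" using False assms by linarith
    then show ?thesis by (auto simp: power2_eq_square)
  qed
  finally show ?thesis .
qed

text \<open>One bound for two exponents: \<open>j = k\<close> serves the edges meeting a
  \<open>k\<close>-set, \<open>j = 2 * k\<close> the edges leaving it. After
  \<open>1 - p n <= exp (- p n)\<close>, the factor \<open>exp (- k * ln n)\<close> cancels the
  \<open>n ^ k\<close> from the binomial coefficient; what remains is essentially
  \<open>exp (p n * j / 2) ^ k\<close>, and \<open>exp_mult_ln_div_le\<close> controls its base by a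
  multiple of \<open>sqrt k\<close>.\<close>

lemma binomial_power_le:
  fixes c :: real
  defines "p \<equiv> \<lambda>n. (ln (real n) + c) / real n"
  assumes p: "0 \<le> p n" "p n \<le> 1"
    and j: "1 \<le> j" "j \<le> n" "j \<le> 2 * k"
    and m: "real k * (2 * real n - real j) \<le> 2 * real m + 2 * real k"
  shows "real (n choose k) * (1 - p n) ^ m \<le> (4 * exp (1 + 2 * \<bar>c\<bar>) * sqrt k) ^ k / fact k"
proof -
  have n: "n > 0" using j by auto
  have pn: "p n * real n = ln (real n) + c"
    using n by (simp add: p_def)
  have jn: "c * real j / real n \<le> 2 * \<bar>c\<bar>"
  proof -
    have "c * (real j / real n) \<le> \<bar>c\<bar> * 1"
      using j n by (intro mult_mono) auto
    then show ?thesis by simp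
  qed
  have "exp (p n * real j) = exp (real j * ln (real n) / real n) * exp (c * real j / real n)"
    by (simp add: p_def add_divide_distrib ring_distribs mult_ac flip: exp_add)
  also have "\<dots> \<le> (16 * real k) * exp (2 * \<bar>c\<bar>)"
  proof (intro mult_mono)
    have "8 * real j \<le> 16 * real k" using j by simp
    with exp_mult_ln_div_le[OF j(1,2)] show "exp (real j * ln (real n) / real n) \<le> 16 * real k"
      by linarith
  qed (use jn in auto)
  \<comment> \<open>Only half of the exponent \<open>p n * j\<close> occurs below; halving it turns
    the bound linear in \<open>k\<close> into \<open>sqrt k\<close>, which is what makes the
    majorant summable against \<open>fact k\<close>.\<close>
  finally have "sqrt (exp (p n * real j)) \<le> sqrt (16 * real k * exp (2 * \<bar>c\<bar>))"
    by (rule real_sqrt_le_mono)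
  moreover have "sqrt (exp (p n * real j)) = exp (p n * real j / 2)"
    by (rule real_sqrt_unique) (auto simp: power2_eq_square simp flip: exp_add)
  moreover have "sqrt (exp (2 * \<bar>c\<bar>)) = exp \<bar>c\<bar>"
    by (rule real_sqrt_unique) (auto simp: power2_eq_square simp flip: exp_add)
  moreover have "sqrt (16 :: real) = 4"
    by (rule real_sqrt_unique) auto
  ultimately have ej: "exp (p n * real j / 2) \<le> 4 * sqrt k * exp \<bar>c\<bar>"
    by (simp add: real_sqrt_mult)
  have "(1 - p n) ^ m \<le> exp (- p n) ^ m"
    using p exp_ge_add_one_self[of "- p n"] by (intro power_mono) auto
  also have "\<dots> = exp (- p n * real m)"
    by (simp add: mult.commute flip: exp_of_nat_mult)
  also have "\<dots> \<le> exp (real k * (1 - ln (real n) + \<bar>c\<bar> + p n * real j / 2))"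
  proof -
    \<comment> \<open>Since \<open>p n <= 1\<close>, the slack \<open>2 * k\<close> in the
      assumption on \<open>m\<close> costs only a factor \<open>exp 1 ^ k\<close>.\<close>
    have "p n * (real k * (2 * real n - real j)) \<le> p n * (2 * real m) + 1 * (2 * real k)"
      using mult_left_mono[OF m p(1)] mult_right_mono[OF p(2), of "2 * real k"]
      by (simp add: ring_distribs)
    then have "2 * (real k * (p n * real n)) - p n * real k * real j
        \<le> p n * (2 * real m) + 2 * real k"
      by (simp add: algebra_simps)
    then have "2 * (real k * ln (real n)) + 2 * (real k * c) - p n * real k * real j
        \<le> p n * (2 * real m) + 2 * real k"
      unfolding pn by (simp add: ring_distribs)
    moreover have "real k * (- c) \<le> real k * \<bar>c\<bar>"
      by (intro mult_left_mono) auto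
    ultimately show ?thesis by (simp add: algebra_simps)
  qed
  also have "\<dots> = (exp (1 + \<bar>c\<bar>) * exp (p n * real j / 2)) ^ k / real n ^ k"
  proof -
    have "exp (1 - ln (real n) + \<bar>c\<bar> + p n * real j / 2)
        = exp (1 + \<bar>c\<bar>) * exp (p n * real j / 2) / real n"
      using n by (simp add: exp_add exp_diff)
    then show ?thesis
      by (simp add: exp_of_nat_mult power_divide)
  qed
  also have "\<dots> \<le> (exp (1 + \<bar>c\<bar>) * (4 * sqrt k * exp \<bar>c\<bar>)) ^ k / real n ^ k"
    using ej by (intro divide_right_mono power_mono mult_left_mono) auto
  also have "exp (1 + \<bar>c\<bar>) * (4 * sqrt k * exp \<bar>c\<bar>) = 4 * exp (1 + 2 * \<bar>c\<bar>) * sqrt k"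
    by (simp add: algebra_simps flip: exp_add)
  finally have *: "(1 - p n) ^ m \<le> (4 * exp (1 + 2 * \<bar>c\<bar>) * sqrt k) ^ k / real n ^ k" .
  have "real ((n choose k) * fact k) \<le> real (n ^ k)"
    using binomial_fact_pow of_nat_le_iff by blast
  then have "real (n choose k) \<le> real n ^ k / fact k"
    by (simp add: divide_simps)
  then have "real (n choose k) * (1 - p n) ^ m
      \<le> (real n ^ k / fact k) * ((4 * exp (1 + 2 * \<bar>c\<bar>) * sqrt k) ^ k / real n ^ k)"
    using p by (intro mult_mono *) auto
  then show ?thesis using n by simp
qed

text \<open>By \<open>k ^ k / fact k <= exp 1 ^ k\<close>, the term is at most
  \<open>(4 * B * exp 1 / sqrt k) ^ k\<close>, eventually below a geometric sequence. The weight
  \<open>k ^ 2\<close> is meant for the union bound, where it majorizes the number of edges inside a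
  \<open>k\<close>-set.\<close>

lemma summable_sqrt_power_over_fact:
  fixes B :: real
  assumes "B > 0"
  shows "summable (\<lambda>k. real k ^ 2 * ((B * sqrt k) ^ k / fact k))"
proof (rule summable_comparison_test_ev)
  show "\<forall>\<^sub>F k in sequentially. norm (real k ^ 2 * ((B * sqrt k) ^ k / fact k)) \<le> (1 / 2) ^ k"
  proof -
    \<comment> \<open>The threshold forces \<open>4 * (B / sqrt k) * exp 1 < 1 / 2\<close>, the 4
      coming from \<open>k ^ 2 <= 4 ^ k\<close>.\<close>
    have "\<forall>\<^sub>F k in sequentially. sqrt (real k) > 8 * B * exp 1"
      by real_asymp
    then show ?thesis using eventually_gt_at_top[of 0]
    proof eventually_elim
      case (elim k)
      have "real k ^ k / fact k = real k ^ k /\<^sub>R fact k" by (simp add: divide_inverse)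
      also have "\<dots> \<le> (\<Sum>i. real k ^ i /\<^sub>R fact i)"
        using sum_le_suminf[OF summable_exp_generic[of "real k"], of "{k}"] by simp
      also have "\<dots> = exp (real k)" by (simp add: exp_def)
      also have "\<dots> = exp 1 ^ k" by (simp flip: exp_of_nat_mult)
      finally have kk: "real k ^ k / fact k \<le> exp 1 ^ k" .
      have "real k \<le> 2 ^ k" by (simp add: less_imp_le)
      then have "real k ^ 2 \<le> (2 ^ k) ^ 2" by (intro power_mono) auto
      then have k2: "real k ^ 2 \<le> 4 ^ k" by (simp add: power2_eq_square flip: power_mult_distrib)
      have "sqrt k ^ k * sqrt k ^ k = real k ^ k"
        by (simp flip: power_mult_distrib)
      then have "(B * sqrt k) ^ k / fact k = (B / sqrt k) ^ k * (real k ^ k / fact k)"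
        using elim by (simp add: field_simps)
      also have "\<dots> \<le> (B / sqrt k) ^ k * exp 1 ^ k"
        using assms elim by (intro mult_left_mono kk) auto
      finally have "real k ^ 2 * ((B * sqrt k) ^ k / fact k)
          \<le> 4 ^ k * ((B / sqrt k) ^ k * exp 1 ^ k)"
        using assms by (intro mult_mono k2) auto
      also have "\<dots> = (4 * (B / sqrt k) * exp 1) ^ k"
        by (simp only: power_mult_distrib mult_ac)
      also have "\<dots> \<le> (1 / 2) ^ k"
        using elim assms by (intro power_mono) (auto simp: field_simps)
      finally show ?case using assms by simp
    qed
  qed
qed (simp add: summable_geometric)

section \<open>Termwise limits and the limit of the alternating sum\<close>

lemma tendsto_binomial_over_power:
  "(\<lambda>n. real (n choose k) / real n ^ k) \<longlonglongrightarrow> 1 / fact k"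
proof -
  have "(\<lambda>n. (\<Prod>i<k. (real n - real i) / real n) / fact k) \<longlonglongrightarrow> (\<Prod>i<k. 1) / fact k"
    by (intro tendsto_divide tendsto_prod tendsto_const) (real_asymp | simp)+
  moreover have "(\<Prod>i<k. (real n - real i) / real n) / fact k = real (n choose k) / real n ^ k" for n
    by (simp add: binomial_gbinomial gbinomial_prod_rev prod_dividef atLeast0LessThan)
  ultimately show ?thesis by simp
qed

text \<open>The expression factors into \<open>(n choose k) / n ^ k\<close>, the \<open>k\<close>-th
  power of \<open>n * (1 - p n) ^ n\<close>, whose limit is \<open>exp (- c)\<close>, and a division
  by \<open>(1 - p n) ^ d\<close>, which tends to 1 because \<open>d\<close> is fixed.\<close>

lemma tendsto_binomial_power:
  fixes c :: real
  defines "p \<equiv> \<lambda>n. (ln (real n) + c) / real n"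
  shows "(\<lambda>n. real (n choose k) * (1 - p n) ^ (k * n - d)) \<longlonglongrightarrow> exp (- c) ^ k / fact k"
proof -
  have "p \<longlonglongrightarrow> 0" unfolding p_def by real_asymp
  then have p1: "\<forall>\<^sub>F n in sequentially. p n < 1" by (rule order_tendstoD) simp
  have "(\<lambda>n. exp (ln (real n) + real n * ln (1 - p n))) \<longlonglongrightarrow> exp (- c)"
    unfolding p_def by real_asymp
  then have "(\<lambda>n. real n * (1 - p n) ^ n) \<longlonglongrightarrow> exp (- c)"
  proof (rule Lim_transform_eventually)
    show "\<forall>\<^sub>F n in sequentially. exp (ln (real n) + real n * ln (1 - p n)) = real n * (1 - p n) ^ n"
      using p1 eventually_gt_at_top[of 0]
      by eventually_elim (simp add: exp_add exp_of_nat_mult)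
  qed
  then have "(\<lambda>n. real (n choose k) / real n ^ k * (real n * (1 - p n) ^ n) ^ k / (1 - p n) ^ d)
      \<longlonglongrightarrow> 1 / fact k * exp (- c) ^ k / (1 - 0) ^ d"
    using \<open>p \<longlonglongrightarrow> 0\<close>
    by (intro tendsto_intros tendsto_binomial_over_power) auto
  then have "(\<lambda>n. real (n choose k) / real n ^ k * (real n * (1 - p n) ^ n) ^ k / (1 - p n) ^ d)
      \<longlonglongrightarrow> exp (- c) ^ k / fact k" by simp
  then show ?thesis
  \<comment> \<open>For \<open>k > 0\<close>, eventually \<open>d <= k * n\<close> and the exponent
    can be split. For \<open>k = 0\<close> the truncated subtraction gives exponent 0, and the
    sequence is constantly 1.\<close>
  proof (cases "k = 0")
    case False
    show ?thesis
    proof (rule Lim_transform_eventually)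
      show "\<forall>\<^sub>F n in sequentially. real (n choose k) / real n ^ k * (real n * (1 - p n) ^ n) ^ k
          / (1 - p n) ^ d = real (n choose k) * (1 - p n) ^ (k * n - d)"
        using p1 eventually_gt_at_top[of 0] eventually_ge_at_top[of d]
      proof eventually_elim
        case (elim n)
        have "d \<le> k * n" using elim False by (metis le_trans mult_le_mono1 mult_1 Suc_leI neq0_conv One_nat_def)
        then have "(1 - p n) ^ (k * n - d) = (1 - p n) ^ (k * n) / (1 - p n) ^ d"
          using elim by (simp add: power_diff)
        then show ?case using elim
          by (simp add: power_mult_distrib mult.commute flip: power_mult)
      qed
    qed fact
  qed simp
qed

lemma alternating_sum_tendsto:
  fixes c :: real
  defines "p \<equiv> \<lambda>n. (ln (real n) + c) / real n"
  shows "(\<lambda>n. \<Sum>k\<le>n. (-1) ^ k * real (n choose k) * (1 - p n) ^ (k * n - (Suc k choose 2)))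
           \<longlonglongrightarrow> exp (- exp (- c))"
proof -
  define B where "B = 4 * exp (1 + 2 * \<bar>c\<bar>)"
  define a where "a k n = (-1) ^ k * real (n choose k) * (1 - p n) ^ (k * n - (Suc k choose 2))" for k n
  have "p \<longlonglongrightarrow> 0" unfolding p_def by real_asymp
  then have p1: "\<forall>\<^sub>F n in sequentially. p n < 1" by (rule order_tendstoD) simp
  have p0: "\<forall>\<^sub>F n in sequentially. p n \<ge> 0" unfolding p_def by real_asymp
  \<comment> \<open>The case \<open>k = 0\<close> must be excluded: the majorant vanishes there
    while \<open>a 0 n = 1\<close>. Tannery's theorem asks for the bound only eventually in
    \<open>k\<close>.\<close>
  have bound: "norm (a k n) \<le> real k ^ 2 * ((B * sqrt k) ^ k / fact k)"
    if p: "0 \<le> p n" "p n < 1" and k: "k > 0" for k n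
  proof (cases "k \<le> n")
    case True
    have choose2: "real (Suc k choose 2) = real k * (real k + 1) / 2"
      by (induction k) (simp_all add: numeral_2_eq_2 field_simps)
    have "Suc k * k \<le> 2 * (k * n)"
      using True k by (intro order.trans[OF mult_le_mono1[of "Suc k" "2 * n" k]]) auto
    \<comment> \<open>This makes the natural-number subtraction in the exponent exact.\<close>
    then have "(Suc k choose 2) \<le> k * n"
      by (simp add: choose_two)
    then have "2 * real (k * n - (Suc k choose 2)) = 2 * real k * real n - real k * (real k + 1)"
      by (simp add: of_nat_diff choose2 algebra_simps)
    then have "real k * (2 * real n - real k) \<le> 2 * real (k * n - (Suc k choose 2)) + 2 * real k"
      by (simp add: algebra_simps)
    then have "norm (a k n) \<le> (B * sqrt k) ^ k / fact k"
      using binomial_power_le[of n c k k "k * n - (Suc k choose 2)"] p k True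
      by (simp add: a_def p_def B_def abs_mult)
    also have "\<dots> \<le> real k ^ 2 * ((B * sqrt k) ^ k / fact k)"
      using mult_right_mono[of 1 "real k ^ 2" "(B * sqrt k) ^ k / fact k"] k by (simp add: B_def)
    finally show ?thesis .
  qed (simp add: a_def B_def binomial_eq_0)
  have "(\<lambda>n. suminf (\<lambda>k. a k n)) \<longlonglongrightarrow> suminf (\<lambda>k. (-1) ^ k * (exp (- c) ^ k / fact k))"
  proof (intro tannerys_theorem[THEN conjunct2, THEN conjunct2])
    show "(\<lambda>n. a k n) \<longlonglongrightarrow> (-1) ^ k * (exp (- c) ^ k / fact k)" for k
      using tendsto_mult[OF tendsto_const tendsto_binomial_power[of k c "Suc k choose 2"], of "(-1) ^ k"]
      by (simp add: a_def p_def mult_ac)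
    show "summable (\<lambda>k. real k ^ 2 * ((B * sqrt k) ^ k / fact k))"
      by (rule summable_sqrt_power_over_fact) (simp add: B_def)
    show "\<forall>\<^sub>F (k, n) in at_top \<times>\<^sub>F sequentially.
        norm (a k n) \<le> real k ^ 2 * ((B * sqrt k) ^ k / fact k)"
      using eventually_prodI[OF eventually_gt_at_top[of 0] eventually_conj[OF p0 p1]]
      by eventually_elim (use bound in force)
  qed simp
  \<comment> \<open>The binomial coefficient is 0 for \<open>k > n\<close>, so the series is the
    finite sum.\<close>
  moreover have "suminf (\<lambda>k. a k n) = (\<Sum>k\<le>n. a k n)" for n
    by (rule suminf_finite) (auto simp: a_def)
  moreover have "suminf (\<lambda>k. (-1) ^ k * (exp (- c) ^ k / fact k)) = exp (- exp (- c))"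
    using exp_converges[of "- exp (- c)"]
    by (intro sums_unique[symmetric]) (simp add: power_minus[of "exp (- c)"] divide_inverse mult_ac)
  ultimately show ?thesis
    by (simp add: a_def)
qed

section \<open>Independent edges and connectedness in terms of cuts\<close>

definition edge_pmf :: "nat \<Rightarrow> real \<Rightarrow> (nat set \<Rightarrow> bool) pmf" where
  "edge_pmf n p = Pi_pmf (possible_edges n) False (\<lambda>_. bernoulli_pmf p)"

text \<open>Edges have two elements, so the condition amounts to exactly one endpoint in
  \<open>S\<close>, without naming the endpoints.\<close>

definition cut_edges :: "nat \<Rightarrow> nat set \<Rightarrow> nat set set" where
  "cut_edges n S = {e \<in> possible_edges n. e \<inter> S \<noteq> {} \<and> e - S \<noteq> {}}"

lemma finite_possible_edges [simp]: "finite (possible_edges n)"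
  by (rule finite_subset[of _ "Pow {..<n}"]) (auto simp: possible_edges_def)

lemma doubleton_in_possible_edges_iff:
  "{u, v} \<in> possible_edges n \<longleftrightarrow> u < n \<and> v < n \<and> u \<noteq> v"
  by (cases "u = v") (auto simp: possible_edges_def)

text \<open>A walk from inside \<open>S\<close> to outside must cross the cut; conversely, the set
  reachable from \<open>u\<close> has an empty cut and therefore contains every vertex.\<close>

lemma connected_simple_graph_iff:
  assumes E: "E \<subseteq> possible_edges n" and n: "n > 0"
  shows "Digraph_Component.connected (with_proj (simple_graph n E)) \<longleftrightarrow>
    (\<forall>S. S \<noteq> {} \<and> S \<subset> {..<n} \<longrightarrow> E \<inter> cut_edges n S \<noteq> {})" (is "?L \<longleftrightarrow> ?R")
proof -
  define r where "r = {(u, v). {u, v} \<in> E}"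
  interpret pair_graph "simple_graph n E"
    using E by (rule pair_graph_simple_graph)
  \<comment> \<open>Connectedness is defined through the symmetric closure of the arcs, which adds
    nothing here because both orientations are present.\<close>
  have ends: "(arcs_ends (with_proj (simple_graph n E)))\<^sup>s = r"
    by (auto simp: r_def simple_graph_def arcs_ends_def arc_to_ends_def insert_commute symcl_def)
  have r: "u < n \<and> v < n" if "(u, v) \<in> r" for u v
    using that E doubleton_in_possible_edges_iff[of u v n] by (auto simp: r_def)
  \<comment> \<open>Connectedness includes a nonempty vertex set; this is where \<open>n > 0\<close>
    enters, the cut condition being vacuous for \<open>n = 0\<close>.\<close>
  have conn: "?L \<longleftrightarrow> (\<forall>u<n. \<forall>v<n. (u, v) \<in> rtrancl_on {..<n} r)"
  proof -
    have "verts (with_proj (simple_graph n E)) = {..<n}"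
      by (simp add: simple_graph_def)
    then show ?thesis
      unfolding connected_conv ends using n by (auto simp: Ball_def)
  qed
  show ?thesis
  proof
    assume ?L
    show ?R
    proof (intro allI impI)
      fix S assume S: "S \<noteq> {} \<and> S \<subset> {..<n}"
      then obtain u v where uv: "u \<in> S" "v < n" "v \<notin> S" by auto
      then have "(u, v) \<in> rtrancl_on {..<n} r"
        using S \<open>?L\<close> conn by auto
      then have "\<exists>x y. (x, y) \<in> r \<and> x \<in> S \<and> y \<notin> S"
        using uv(1,3) by induction auto
      then obtain x y where "{x, y} \<in> E" "x \<in> S" "y \<notin> S" by (auto simp: r_def)
      then have "{x, y} \<in> E \<inter> cut_edges n S"
        using E by (auto simp: cut_edges_def)
      then show "E \<inter> cut_edges n S \<noteq> {}" by blast
    qed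
  next
    assume R: ?R
    show ?L unfolding conn
    proof (intro allI impI)
      fix u v assume uv: "u < n" "v < n"
      define S where "S = {w. (u, w) \<in> rtrancl_on {..<n} r}"
      have "u \<in> S" "S \<subseteq> {..<n}"
        using uv by (auto simp: S_def dest: in_rtrancl_on_in_F)
      moreover have "E \<inter> cut_edges n S = {}"
      proof (rule ccontr)
        assume "E \<inter> cut_edges n S \<noteq> {}"
        then obtain e x y where e: "e \<in> E" "e \<in> possible_edges n" "x \<in> e" "x \<in> S" "y \<in> e" "y \<notin> S"
          by (auto simp: cut_edges_def)
        then have "card e = 2" "x \<noteq> y" by (auto simp: possible_edges_def)
        with e have "e = {x, y}" by (auto simp: card_2_iff)
        with e have "(x, y) \<in> r" by (simp add: r_def)
        with \<open>x \<in> S\<close> r have "y \<in> S"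
          by (auto simp: S_def intro: rtrancl_on_into_rtrancl_on)
        with e show False by simp
      qed
      ultimately have "S = {..<n}" using R by blast
      then show "(u, v) \<in> rtrancl_on {..<n} r"
        using uv by (auto simp: S_def)
    qed
  qed
qed

text \<open>The event is a box in the product space, so its probability factors over the
  edges.\<close>

lemma prob_edge_pmf:
  assumes p: "0 \<le> p" "p \<le> 1"
    and FG: "F \<subseteq> possible_edges n" "G \<subseteq> possible_edges n" "F \<inter> G = {}"
  shows "measure_pmf.prob (edge_pmf n p) {f. (\<forall>e\<in>F. f e) \<and> (\<forall>e\<in>G. \<not> f e)}
           = p ^ card F * (1 - p) ^ card G"
proof -
  define B where "B e = (if e \<in> F then {True} else if e \<in> G then {False} else UNIV)" for e
  have "{f. (\<forall>e\<in>F. f e) \<and> (\<forall>e\<in>G. \<not> f e)} = Pi (possible_edges n) B"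
    using FG by (auto simp: B_def Pi_def)
  then have "measure_pmf.prob (edge_pmf n p) {f. (\<forall>e\<in>F. f e) \<and> (\<forall>e\<in>G. \<not> f e)}
      = (\<Prod>e\<in>possible_edges n. measure_pmf.prob (bernoulli_pmf p) (B e))"
    by (simp add: edge_pmf_def measure_Pi_pmf_Pi)
  also have "\<dots> = (\<Prod>e\<in>possible_edges n. (if e \<in> F then p else 1) * (if e \<in> G then 1 - p else 1))"
    using FG p by (intro prod.cong) (auto simp: B_def measure_pmf_single)
  also have "\<dots> = p ^ card (possible_edges n \<inter> F) * (1 - p) ^ card (possible_edges n \<inter> G)"
    by (simp add: prod.distrib prod.If_cases)
  finally show ?thesis
    using FG by (simp add: Int_absorb1)
qed

section \<open>Counting edges that meet or leave a vertex set\<close>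

text \<open>The edges avoiding \<open>T\<close> are the 2-subsets of its complement; subtract them
  from all edges.\<close>

lemma card_edges_meeting:
  assumes "T \<subseteq> {..<n}"
  shows "card {e \<in> possible_edges n. e \<inter> T \<noteq> {}} = card T * n - (Suc (card T) choose 2)"
proof -
  have fin: "finite T" using assms finite_subset by blast
  have le: "card T \<le> n" using card_mono[OF _ assms] by simp
  have "{e \<in> possible_edges n. e \<inter> T \<noteq> {}} = possible_edges n - {e. e \<subseteq> {..<n} - T \<and> card e = 2}"
    by (auto simp: possible_edges_def)
  also have "card \<dots> = card (possible_edges n) - card {e. e \<subseteq> {..<n} - T \<and> card e = 2}"
  proof (rule card_Diff_subset)
    show sub: "{e. e \<subseteq> {..<n} - T \<and> card e = 2} \<subseteq> possible_edges n"
      by (auto simp: possible_edges_def)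
    show "finite {e. e \<subseteq> {..<n} - T \<and> card e = 2}"
      by (rule finite_subset[OF sub finite_possible_edges])
  qed
  also have "card {e. e \<subseteq> {..<n} - T \<and> card e = 2} = (n - card T choose 2)"
    using assms fin by (subst n_subsets) (auto simp: card_Diff_subset)
  also have "card (possible_edges n) = (n choose 2)"
    unfolding possible_edges_def by (subst n_subsets) auto
  also have "(n choose 2) - (n - card T choose 2) = card T * n - (Suc (card T) choose 2)"
  proof -
    obtain m where m: "n = card T + m" using le le_iff_add by blast
    have "(card T + m choose 2) = (card T choose 2) + (m choose 2) + card T * m"
      using vandermonde[of "card T" m 2] by (simp add: numeral_2_eq_2 mult_ac)
    \<comment> \<open>With Vandermonde's identity this reduces both sides to
      \<open>(t choose 2) + t * m\<close> for \<open>t = card T\<close>, while staying in the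
      natural numbers.\<close>
    moreover have "t * t = (Suc t choose 2) + (t choose 2)" for t :: nat
      by (induction t) (auto simp: numeral_2_eq_2)
    from this[of "card T"] have "card T * (card T + m)
        = (Suc (card T) choose 2) + (card T choose 2) + card T * m"
      by (simp only: add_mult_distrib2)
    ultimately show ?thesis
      unfolding m add_diff_cancel_left' by linarith
  qed
  finally show ?thesis .
qed

text \<open>Listing the endpoint in \<open>S\<close> first identifies cut edges with pairs from
  \<open>S\<close> and its complement.\<close>

lemma card_cut_edges:
  assumes "S \<subseteq> {..<n}"
  shows "card (cut_edges n S) = card S * (n - card S)"
proof -
  have fin: "finite S" using assms finite_subset by blast
  have "cut_edges n S = (\<lambda>(u, v). {u, v}) ` (S \<times> ({..<n} - S))"
  proof (intro equalityI subsetI)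
    fix e assume "e \<in> cut_edges n S"
    then obtain x y where e: "e \<in> possible_edges n" "x \<in> e" "x \<in> S" "y \<in> e" "y \<notin> S"
      by (auto simp: cut_edges_def)
    then have "card e = 2" "x \<noteq> y" "y < n" by (auto simp: possible_edges_def)
    with e have "e = {x, y}" by (auto simp: card_2_iff)
    with e \<open>y < n\<close> show "e \<in> (\<lambda>(u, v). {u, v}) ` (S \<times> ({..<n} - S))" by force
  qed (use assms in \<open>auto simp: cut_edges_def doubleton_in_possible_edges_iff\<close>)
  moreover have "inj_on (\<lambda>(u, v). {u, v}) (S \<times> ({..<n} - S))"
    by (auto simp: inj_on_def doubleton_eq_iff)
  ultimately show ?thesis
    using assms fin by (simp add: card_image card_cartesian_product card_Diff_subset)
qed

lemma sum_Pow_card: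
  fixes g :: "nat \<Rightarrow> real"
  assumes "finite A"
  shows "(\<Sum>S\<in>Pow A. g (card S)) = (\<Sum>k\<le>card A. real (card A choose k) * g k)"
proof -
  have "(\<Sum>S\<in>Pow A. g (card S)) = (\<Sum>k\<le>card A. \<Sum>S\<in>{S \<in> Pow A. card S = k}. g (card S))"
    using assms by (intro sum.group[symmetric]) (auto intro: card_mono)
  also have "\<dots> = (\<Sum>k\<le>card A. real (card A choose k) * g k)"
    using n_subsets[OF assms] by (intro sum.cong) auto
  finally show ?thesis .
qed

section \<open>Isolated vertices by inclusion-exclusion\<close>

definition no_isolated :: "nat \<Rightarrow> (nat set \<Rightarrow> bool) set" where
  "no_isolated n = {f. \<forall>v<n. \<exists>e\<in>possible_edges n. v \<in> e \<and> f e}"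

text \<open>All vertices of \<open>T\<close> are isolated exactly when every edge meeting
  \<open>T\<close> is absent, so each inclusion-exclusion term depends only on
  \<open>card T\<close>.\<close>

lemma prob_no_isolated:
  assumes p: "0 \<le> p" "p \<le> 1"
  shows "measure_pmf.prob (edge_pmf n p) (no_isolated n) =
    (\<Sum>k\<le>n. (-1) ^ k * real (n choose k) * (1 - p) ^ (k * n - (Suc k choose 2)))"
proof -
  define iso where "iso v = {f. \<forall>e\<in>possible_edges n. v \<in> e \<longrightarrow> \<not> f e}" for v
  define g where "g k = (-1) ^ k * (1 - p) ^ (k * n - (Suc k choose 2))" for k
  let ?P = "measure_pmf.prob (edge_pmf n p)"
  have P: "(-1) ^ card T * ?P (\<Inter>(iso ` T)) = g (card T)" if "T \<subseteq> {..<n}" for T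
  proof -
    have "\<Inter>(iso ` T) = {f. (\<forall>e\<in>{}. f e) \<and> (\<forall>e\<in>{e \<in> possible_edges n. e \<inter> T \<noteq> {}}. \<not> f e)}"
      by (auto simp: iso_def)
    then show ?thesis
      using prob_edge_pmf[OF p, of "{}" n "{e \<in> possible_edges n. e \<inter> T \<noteq> {}}"]
        card_edges_meeting[OF that] by (simp add: g_def)
  qed
  have "no_isolated n = - (\<Union>v<n. iso v)"
    by (auto simp: no_isolated_def iso_def)
  then have "?P (no_isolated n) = 1 - ?P (\<Union>v<n. iso v)"
    using measure_pmf.prob_compl[of "\<Union>v<n. iso v" "edge_pmf n p"] by (simp add: Compl_eq_Diff_UNIV)
  also have "?P (\<Union>v<n. iso v)
      = (\<Sum>T | T \<subseteq> {..<n} \<and> T \<noteq> {}. (-1) ^ (card T + 1) * ?P (\<Inter>(iso ` T)))"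
    by (intro Incl_Excl_UN) (auto simp: disjnt_def measure_pmf.finite_measure_Union)
  also have "\<dots> = (\<Sum>T | T \<subseteq> {..<n} \<and> T \<noteq> {}. - g (card T))"
    using P by (intro sum.cong) auto
  \<comment> \<open>The leading 1 is \<open>g 0\<close>, the missing term for the empty set, so the
    sum extends to the full power set.\<close>
  also have "1 - \<dots> = g 0 + (\<Sum>T | T \<subseteq> {..<n} \<and> T \<noteq> {}. g (card T))"
    by (simp add: g_def sum_negf)
  also have "\<dots> = (\<Sum>T\<in>Pow {..<n}. g (card T))"
    by (subst sum.remove[of "Pow {..<n}" "{}"]) (auto intro!: sum.cong)
  finally show ?thesis
    using sum_Pow_card[of "{..<n}" g] by (simp add: g_def mult_ac)
qed

section \<open>Disconnected graphs without isolated vertices\<close>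

text \<open>The connectedness event for edge indicators, by
  \<open>connected_simple_graph_iff\<close> when \<open>n > 0\<close>.\<close>

definition cut_free :: "nat \<Rightarrow> (nat set \<Rightarrow> bool) set" where
  "cut_free n = {f. \<forall>S. S \<noteq> {} \<and> S \<subset> {..<n} \<longrightarrow> (\<exists>e\<in>cut_edges n S. f e)}"

lemma prob_gnp_connected:
  assumes "n > 0"
  shows "measure_pmf.prob (gnp n p) {G. Digraph_Component.connected (with_proj G)}
           = measure_pmf.prob (edge_pmf n p) (cut_free n)"
proof -
  have "Digraph_Component.connected (with_proj (simple_graph n {e \<in> possible_edges n. f e}))
      \<longleftrightarrow> f \<in> cut_free n" for f
    using assms by (subst connected_simple_graph_iff) (auto simp: cut_free_def cut_edges_def disjoint_iff; blast)+
  then show ?thesis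
    by (simp add: gnp_def edge_pmf_def vimage_def)
qed

text \<open>Apply the cut condition to singletons. These are proper subsets only for
  \<open>n >= 2\<close>; a one-vertex graph is connected with an isolated vertex.\<close>

lemma cut_free_subset_no_isolated:
  assumes "n \<ge> 2"
  shows "cut_free n \<subseteq> no_isolated n"
proof
  fix f assume f: "f \<in> cut_free n"
  show "f \<in> no_isolated n" unfolding no_isolated_def
  proof (intro CollectI allI impI)
    fix v assume v: "v < n"
    have "card {v} \<noteq> card {..<n}"
      using assms by simp
    then have "{v} \<noteq> {..<n}" by metis
    with v f obtain e where "e \<in> cut_edges n {v}" "f e"
      unfolding cut_free_def by blast
    then show "\<exists>e\<in>possible_edges n. v \<in> e \<and> f e"
      by (auto simp: cut_edges_def)
  qed
qed

text \<open>A set and its complement have the same cut, so the smaller one may be chosen as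
  \<open>S\<close>. A vertex of \<open>S\<close> has a present edge; it cannot cross the cut, so it
  lies inside \<open>S\<close> and forces \<open>card S >= 2\<close>.\<close>

lemma no_isolated_minus_cut_free_subset:
  "no_isolated n - cut_free n \<subseteq>
    (\<Union>S\<in>{S. S \<subseteq> {..<n} \<and> 2 \<le> card S \<and> 2 * card S \<le> n}. \<Union>e\<in>{e. e \<subseteq> S \<and> card e = 2}.
       {f. (\<forall>e'\<in>{e}. f e') \<and> (\<forall>e'\<in>cut_edges n S. \<not> f e')})"
proof
  fix f assume f: "f \<in> no_isolated n - cut_free n"
  then obtain S0 where S0: "S0 \<noteq> {}" "S0 \<subset> {..<n}" "\<And>e. e \<in> cut_edges n S0 \<Longrightarrow> \<not> f e"
    by (auto simp: cut_free_def)
  have "cut_edges n ({..<n} - S0) = cut_edges n S0"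
    by (auto simp: cut_edges_def possible_edges_def)
  moreover have "card ({..<n} - S0) = n - card S0"
    using S0 by (subst card_Diff_subset) (auto intro: finite_subset)
  moreover define S where "S = (if 2 * card S0 \<le> n then S0 else {..<n} - S0)"
  ultimately have S: "S \<noteq> {}" "S \<subseteq> {..<n}" "\<forall>e\<in>cut_edges n S. \<not> f e" "2 * card S \<le> n"
    using S0 by auto
  then obtain v where v: "v \<in> S" "v < n" by blast
  then obtain e where e: "e \<in> possible_edges n" "v \<in> e" "f e"
    using f by (auto simp: no_isolated_def)
  then have "e \<subseteq> S" "card e = 2"
    using S(3) v by (auto simp: cut_edges_def possible_edges_def)
  moreover have "card e \<le> card S"
    using \<open>e \<subseteq> S\<close> S by (intro card_mono) (auto intro: finite_subset)
  ultimately show "f \<in> (\<Union>S\<in>{S. S \<subseteq> {..<n} \<and> 2 \<le> card S \<and> 2 * card S \<le> n}.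
      \<Union>e\<in>{e. e \<subseteq> S \<and> card e = 2}. {f. (\<forall>e'\<in>{e}. f e') \<and> (\<forall>e'\<in>cut_edges n S. \<not> f e')})"
    using S e by (intro UN_I[of S] UN_I[of e]) auto
qed

text \<open>Union bound over \<open>S\<close> and an edge \<open>e\<close> inside it. As
  \<open>e\<close> is not in the cut, independence yields the extra factor \<open>p\<close>, and
  there are at most \<open>k ^ 2\<close> choices of \<open>e\<close>.\<close>

lemma prob_no_isolated_minus_cut_free_le:
  assumes p: "0 \<le> p" "p \<le> 1"
  shows "measure_pmf.prob (edge_pmf n p) (no_isolated n - cut_free n) \<le>
    p * (\<Sum>k | 2 \<le> k \<and> 2 * k \<le> n. real k ^ 2 * (real (n choose k) * (1 - p) ^ (k * (n - k))))"
proof -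
  let ?P = "measure_pmf.prob (edge_pmf n p)"
  let ?A = "{S. S \<subseteq> {..<n} \<and> 2 \<le> card S \<and> 2 * card S \<le> n}"
  let ?I = "\<lambda>S::nat set. {e. e \<subseteq> S \<and> card e = 2}"
  let ?E = "\<lambda>S e. {f. (\<forall>e'\<in>{e}. f e') \<and> (\<forall>e'\<in>cut_edges n S. \<not> f e')}"
  \<comment> \<open>Setting \<open>h\<close> to 0 outside the admissible sizes lets the sum run over
    the whole power set, as \<open>sum_Pow_card\<close> requires.\<close>
  define h where "h k = (if 2 \<le> k \<and> 2 * k \<le> n then real k ^ 2 * (p * (1 - p) ^ (k * (n - k))) else 0)" for k
  have finA: "finite ?A" by (rule finite_subset[of _ "Pow {..<n}"]) auto
  have inner: "?P (\<Union>e\<in>?I S. ?E S e) \<le> h (card S)" if S: "S \<in> ?A" for S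
  proof -
    have fin: "finite S" using S by (auto intro: finite_subset)
    have finI: "finite (?I S)" by (rule finite_subset[of _ "Pow S"]) (use fin in auto)
    have "?P (\<Union>e\<in>?I S. ?E S e) \<le> (\<Sum>e\<in>?I S. ?P (?E S e))"
      using finI by (intro measure_pmf.finite_measure_subadditive_finite) auto
    also have "\<dots> = (\<Sum>e\<in>?I S. p * (1 - p) ^ (card S * (n - card S)))"
    proof (intro sum.cong refl)
      fix e assume e: "e \<in> ?I S"
      then have "?P (?E S e) = p ^ card {e} * (1 - p) ^ card (cut_edges n S)"
        using S by (intro prob_edge_pmf p) (auto simp: possible_edges_def cut_edges_def)
      then show "?P (?E S e) = p * (1 - p) ^ (card S * (n - card S))"
        using S by (simp add: card_cut_edges)
    qed
    also have "\<dots> = real (card S choose 2) * (p * (1 - p) ^ (card S * (n - card S)))"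
      using n_subsets[OF fin, of 2] by simp
    also have "\<dots> \<le> real (card S ^ 2) * (p * (1 - p) ^ (card S * (n - card S)))"
      using p S by (intro mult_right_mono) (auto intro!: binomial_le_pow simp del: of_nat_power)
    finally show ?thesis using S by (simp add: h_def)
  qed
  have "?P (no_isolated n - cut_free n) \<le> ?P (\<Union>S\<in>?A. \<Union>e\<in>?I S. ?E S e)"
    by (intro measure_pmf.finite_measure_mono no_isolated_minus_cut_free_subset) auto
  also have "\<dots> \<le> (\<Sum>S\<in>?A. ?P (\<Union>e\<in>?I S. ?E S e))"
    using finA by (intro measure_pmf.finite_measure_subadditive_finite) auto
  also have "\<dots> \<le> (\<Sum>S\<in>?A. h (card S))"
    by (intro sum_mono inner)
  also have "\<dots> = (\<Sum>S\<in>Pow {..<n}. h (card S))"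
    by (intro sum.mono_neutral_left) (auto simp: h_def)
  also have "\<dots> = (\<Sum>k\<le>n. real (n choose k) * h k)"
    by (simp add: sum_Pow_card)
  also have "\<dots> = (\<Sum>k | 2 \<le> k \<and> 2 * k \<le> n. real (n choose k) * h k)"
    by (intro sum.mono_neutral_right) (auto simp: h_def)
  finally show ?thesis
    by (simp add: h_def sum_distrib_left mult_ac)
qed

section \<open>Passage to the limit\<close>

theorem proposition5:
  fixes c :: real
  shows "(\<lambda>n. measure_pmf.prob (gnp n ((ln (real n) + c) / real n))
               {G. Digraph_Component.connected (with_proj G)})
         \<longlonglongrightarrow> exp (- exp (- c))"
proof -
  define p where "p n = (ln (real n) + c) / real n" for n
  define K where "K = (\<Sum>k. real k ^ 2 * ((4 * exp (1 + 2 * \<bar>c\<bar>) * sqrt k) ^ k / fact k))"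
  let ?conn = "\<lambda>n. measure_pmf.prob (gnp n (p n)) {G. Digraph_Component.connected (with_proj G)}"
  let ?noiso = "\<lambda>n. measure_pmf.prob (edge_pmf n (p n)) (no_isolated n)"
  have lim: "p \<longlonglongrightarrow> 0" unfolding p_def by real_asymp
  then have "\<forall>\<^sub>F n in sequentially. p n < 1" by (rule order_tendstoD) simp
  moreover have "\<forall>\<^sub>F n in sequentially. p n \<ge> 0" unfolding p_def by real_asymp
  \<comment> \<open>From some \<open>n\<close> on, \<open>p n\<close> is a genuine probability and
    \<open>bernoulli_pmf\<close> truncates nothing.\<close>
  ultimately have ev: "\<forall>\<^sub>F n in sequentially. 0 \<le> p n \<and> p n \<le> 1 \<and> 2 \<le> n"
    using eventually_ge_at_top[of 2] by eventually_elim auto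
  have "?noiso \<longlonglongrightarrow> exp (- exp (- c))"
  proof (rule Lim_transform_eventually)
    show "\<forall>\<^sub>F n in sequentially. (\<Sum>k\<le>n. (-1) ^ k * real (n choose k) *
        (1 - p n) ^ (k * n - (Suc k choose 2))) = ?noiso n"
      using ev by eventually_elim (simp add: prob_no_isolated)
  qed (unfold p_def, rule alternating_sum_tendsto)
  moreover have "(\<lambda>n. ?noiso n - ?conn n) \<longlonglongrightarrow> 0"
  \<comment> \<open>\<open>K\<close> does not depend on \<open>n\<close>, so the factor
    \<open>p n\<close> drives the upper bound to 0.\<close>
  proof (rule tendsto_sandwich[where f = "\<lambda>_. 0" and h = "\<lambda>n. p n * K"])
    show "(\<lambda>n. p n * K) \<longlonglongrightarrow> 0"
      using tendsto_mult_left_zero[OF lim] .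
    have diff: "?noiso n - ?conn n
        = measure_pmf.prob (edge_pmf n (p n)) (no_isolated n - cut_free n)" if "2 \<le> n" for n
      using that cut_free_subset_no_isolated[of n]
      by (simp add: prob_gnp_connected measure_pmf.finite_measure_Diff)
    show "\<forall>\<^sub>F n in sequentially. 0 \<le> ?noiso n - ?conn n"
      using ev by eventually_elim (simp only: diff measure_nonneg)
    show "\<forall>\<^sub>F n in sequentially. ?noiso n - ?conn n \<le> p n * K"
      using ev
    proof eventually_elim
      case (elim n)
      let ?A = "{k. 2 \<le> k \<and> 2 * k \<le> n}"
      have fin: "finite ?A" by (rule finite_subset[of _ "{..n}"]) auto
      have "(\<Sum>k\<in>?A. real k ^ 2 * (real (n choose k) * (1 - p n) ^ (k * (n - k))))
          \<le> (\<Sum>k\<in>?A. real k ^ 2 * ((4 * exp (1 + 2 * \<bar>c\<bar>) * sqrt k) ^ k / fact k))"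
      proof (intro sum_mono mult_left_mono)
        \<comment> \<open>With \<open>j = 2 * k\<close>, the requirement \<open>j <= n\<close> is
          exactly \<open>2 * k <= n\<close>, and \<open>k * (2 * n - j)\<close> is twice the
          exponent \<open>k * (n - k)\<close>.\<close>
        fix k assume k: "k \<in> ?A"
        then show "real (n choose k) * (1 - p n) ^ (k * (n - k))
            \<le> (4 * exp (1 + 2 * \<bar>c\<bar>) * sqrt k) ^ k / fact k"
          unfolding p_def using elim
          by (intro binomial_power_le[where j = "2 * k"]) (auto simp: p_def of_nat_diff algebra_simps)
      qed simp
      also have "\<dots> \<le> K"
        unfolding K_def
        by (intro sum_le_suminf summable_sqrt_power_over_fact fin) auto
      finally have "p n * (\<Sum>k\<in>?A. real k ^ 2 * (real (n choose k) * (1 - p n) ^ (k * (n - k))))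
          \<le> p n * K"
        using elim by (intro mult_left_mono) auto
      then show ?case
        using prob_no_isolated_minus_cut_free_le[of "p n" n] diff[of n] elim by simp
    qed
  qed simp
  ultimately have "(\<lambda>n. ?noiso n - (?noiso n - ?conn n)) \<longlonglongrightarrow> exp (- exp (- c)) - 0"
    by (rule tendsto_diff)
  then show ?thesis by (simp add: p_def)
qed

end
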